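(* For all integers $n \geq 1$ and $1 \leq k \leq n$, the hyperbolicity cone $\Lambda_+(e_k,\mathbf{1})$ of the elementary symmetric polynomial $e_k(x_1,\ldots,x_n)=\sum_{1\leq i_1<\cdots<i_k\leq n} x_{i_1}\cdots x_{i_k}$ with respect to $\mathbf{1}=(1,\ldots,1)^T$ is spectrahedral.
   Context: A homogeneous polynomial $h\in\mathbb{R}[x_1,\ldots,x_n]$ is hyperbolic with respect to $\mathbf{e}\in\mathbb{R}^n$ if $h(\mathbf{e})\neq 0$ and for every $\mathbf{x}\in\mathbb{R}^n$ the univariate polynomial $t\mapsto h(\mathbf{x}+t\mathbf{e})$ has only real zeros. The hyperbolicity cone $\Lambda_+(h,\mathbf{e})$ is the closure of the connected component of $\{\mathbf{x}\in\mathbb{R}^n: h(\mathbf{x})\neq 0\}$ containing $\mathbf{e}$. The polynomial $e_k$ is hyperbolic with respect to $\mathbf{1}$. A cone in $\mathbb{R}^n$ is spectrahedral if it is of the form $\{\mathbf{x}\in\mathbb{R}^n : \sum_{i=1}^n x_iA_i \text{ is positive semidefinite}\}$, where $A_1,\ldots,A_n$ are real symmetric $m\times m$ matrices (for some $m$) such that $\sum_{i=1}^n y_iA_i$ is positive definite for some $(y_1,\ldots,y_n)\in\mathbb{R}^n$. *)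

theory Defs
  imports "HOL-Analysis.Analysis"
begin

definition esym :: "nat \<Rightarrow> real^'n \<Rightarrow> real" where
  "esym k x = (\<Sum>S\<in>{S. card S = k}. \<Prod>i\<in>S. x $ i)"

definition hyperbolicity_cone :: "(real^'n \<Rightarrow> real) \<Rightarrow> real^'n \<Rightarrow> (real^'n) set" where
  "hyperbolicity_cone h e = closure (connected_component_set {x. h x \<noteq> 0} e)"

definition psd_mat :: "nat \<Rightarrow> (nat \<Rightarrow> nat \<Rightarrow> real) \<Rightarrow> bool" where
  "psd_mat m M \<longleftrightarrow> (\<forall>v::nat \<Rightarrow> real. (\<Sum>a<m. \<Sum>b<m. v a * M a b * v b) \<ge> 0)"

definition pd_mat :: "nat \<Rightarrow> (nat \<Rightarrow> nat \<Rightarrow> real) \<Rightarrow> bool" where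
  "pd_mat m M \<longleftrightarrow> (\<forall>v::nat \<Rightarrow> real. (\<exists>a<m. v a \<noteq> 0) \<longrightarrow> (\<Sum>a<m. \<Sum>b<m. v a * M a b * v b) > 0)"

definition symmetric_mat :: "nat \<Rightarrow> (nat \<Rightarrow> nat \<Rightarrow> real) \<Rightarrow> bool" where
  "symmetric_mat m M \<longleftrightarrow> (\<forall>a<m. \<forall>b<m. M a b = M b a)"

definition spectrahedral :: "(real^'n) set \<Rightarrow> bool" where
  "spectrahedral C \<longleftrightarrow>
     (\<exists>(m::nat) (A :: 'n \<Rightarrow> nat \<Rightarrow> nat \<Rightarrow> real).
        (\<forall>i. symmetric_mat m (A i)) \<and>
        (\<exists>y::real^'n. pd_mat m (\<lambda>a b. \<Sum>i\<in>UNIV. y $ i * A i a b)) \<and>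
        C = {x. psd_mat m (\<lambda>a b. \<Sum>i\<in>UNIV. x $ i * A i a b)})"

end

theory Submission
  imports Defs
begin

text \<open>Write \<open>e\<^sub>k(S)\<close> for the elementary symmetric polynomial in the variables indexed by \<open>S\<close>. The ratios
  \<open>R\<^sub>k(S) = e\<^sub>k(S) / e\<^sub>k\<^sub>-\<^sub>1(S)\<close> satisfy
  \<open>k R\<^sub>k(S) = (\<Sum>i\<in>S. x\<^sub>i R\<^sub>k\<^sub>-\<^sub>1(S - i) / (x\<^sub>i + R\<^sub>k\<^sub>-\<^sub>1(S - i)))\<close>, so \<open>R\<^sub>k(S)\<close> is the effective conductance of
  a tree-like electrical network whose edge conductances are linear in \<open>x\<close>. The energy form \<open>Q\<close> of this
  network gives the matrices. Let \<open>C\<close> be the component of \<open>e\<^sub>k \<noteq> 0\<close> containing the all-ones vector, \<open>P\<close>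
  the convex set where \<open>Q\<close> is positive definite, and \<open>G\<close> the set where \<open>e\<^sub>j(S - T) > 0\<close> for all \<open>T\<close>
  with \<open>j + |T| \<le> k\<close>. The identity
  \<open>k e\<^sub>k(S) = e\<^sub>1(S) e\<^sub>k\<^sub>-\<^sub>1(S) - (\<Sum>i\<in>S. x\<^sub>i\<^sup>2 e\<^sub>k\<^sub>-\<^sub>2(S - i))\<close> shows that \<open>G\<close> is relatively closed in \<open>e\<^sub>k \<noteq> 0\<close>, hence
  \<open>C \<subseteq> G\<close>. Completing squares gives \<open>G \<subseteq> P\<close>. On \<open>P\<close> the harmonic potential has energy
  \<open>e\<^sub>k / e\<^sub>k\<^sub>-\<^sub>1 > 0\<close>, hence \<open>P \<subseteq> C\<close> by convexity. So \<open>C = P\<close>, and the closure of \<open>P\<close> is the set where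
  \<open>Q\<close> is positive semidefinite.\<close>

subsection \<open>Elementary symmetric polynomials of subsets of the variables\<close>

definition esum :: "nat \<Rightarrow> 'n::finite set \<Rightarrow> real^'n \<Rightarrow> real" where
  "esum k S x = (\<Sum>T\<in>{T. T \<subseteq> S \<and> card T = k}. \<Prod>i\<in>T. x $ i)"

lemma esym_eq_esum: "esym k x = esum k UNIV x"
  by (simp add: esym_def esum_def)

lemma esum_0 [simp]: "esum 0 S x = 1"
proof -
  have "{T. T \<subseteq> S \<and> card T = 0} = {{}}"
    by (auto simp: card_eq_0_iff)
  then show ?thesis
    by (simp add: esum_def)
qed

lemma esum_insert:
  assumes "a \<notin> S"
  shows "esum (Suc k) (insert a S) x = esum (Suc k) S x + x $ a * esum k S x"
proof -
  let ?F = "\<lambda>j. {T. T \<subseteq> S \<and> card T = j}"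
  have split: "{T. T \<subseteq> insert a S \<and> card T = Suc k} = ?F (Suc k) \<union> insert a ` ?F k"
  proof (intro equalityI subsetI)
    fix T assume T: "T \<in> {T. T \<subseteq> insert a S \<and> card T = Suc k}"
    show "T \<in> ?F (Suc k) \<union> insert a ` ?F k"
    proof (cases "a \<in> T")
      case True
      then have "T = insert a (T - {a})" "T - {a} \<in> ?F k"
        using T by auto
      then show ?thesis by blast
    next
      case False
      then show ?thesis using T by auto
    qed
  next
    fix T assume "T \<in> ?F (Suc k) \<union> insert a ` ?F k"
    then show "T \<in> {T. T \<subseteq> insert a S \<and> card T = Suc k}"
    proof
      assume "T \<in> insert a ` ?F k"
      then obtain U where U: "T = insert a U" "U \<subseteq> S" "card U = k" by auto
      then have "a \<notin> U" using assms by auto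
      then show ?thesis using U by auto
    qed auto
  qed
  have inj: "inj_on (insert a) (?F k)"
    using assms by (intro inj_onI) (metis (no_types, lifting) insert_ident mem_Collect_eq subsetD)
  have "(\<Sum>T\<in>insert a ` ?F k. \<Prod>i\<in>T. x $ i) = (\<Sum>T\<in>?F k. \<Prod>i\<in>insert a T. x $ i)"
    using inj by (simp add: sum.reindex)
  also have "\<dots> = (\<Sum>T\<in>?F k. x $ a * (\<Prod>i\<in>T. x $ i))"
    using assms by (intro sum.cong refl prod.insert) auto
  also have "\<dots> = x $ a * esum k S x"
    by (simp add: esum_def sum_distrib_left)
  finally have image: "(\<Sum>T\<in>insert a ` ?F k. \<Prod>i\<in>T. x $ i) = x $ a * esum k S x" .
  have "?F (Suc k) \<inter> insert a ` ?F k = {}"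
    using assms by auto
  then have "esum (Suc k) (insert a S) x = esum (Suc k) S x + (\<Sum>T\<in>insert a ` ?F k. \<Prod>i\<in>T. x $ i)"
    unfolding esum_def split by (intro sum.union_disjoint) auto
  then show ?thesis
    by (simp only: image)
qed

lemma esum_remove:
  assumes "a \<in> S"
  shows "esum (Suc k) S x = esum (Suc k) (S - {a}) x + x $ a * esum k (S - {a}) x"
  using esum_insert[of a "S - {a}" k x] assms by (simp add: insert_absorb)

lemma esum_Suc_empty [simp]: "esum (Suc k) {} x = 0"
proof -
  have "{T::'a set. T \<subseteq> {} \<and> card T = Suc k} = {}" by auto
  then show ?thesis unfolding esum_def by simp
qed

lemma esum_1: "esum (Suc 0) S x = (\<Sum>i\<in>S. x $ i)"
proof (induction S rule: finite_induct[OF finite])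
  case 1
  then show ?case by simp
next
  case (2 a S)
  then show ?case by (simp add: esum_insert)
qed

text \<open>Double counting: the product over each \<open>Suc k\<close>-subset of \<open>S\<close>
  arises once for every element \<open>i\<close> split off from it.\<close>

lemma esum_euler: "(\<Sum>i\<in>S. x $ i * esum k (S - {i}) x) = real (Suc k) * esum (Suc k) S x"
proof (cases k)
  case 0
  then show ?thesis by (simp add: esum_1)
next
  case k: (Suc k')
  show ?thesis
    unfolding k
  proof (induction S arbitrary: k' rule: finite_induct[OF finite])
    case (1 k')
    then show ?case by simp
  next
    case (2 a S k')
    have k': "(\<Sum>i\<in>S. x $ i * esum k' (S - {i}) x) = real (Suc k') * esum (Suc k') S x"
      using 2 by (cases k') (simp_all add: esum_1)
    have "x $ i * esum (Suc k') (insert a S - {i}) x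
        = x $ i * esum (Suc k') (S - {i}) x + x $ a * (x $ i * esum k' (S - {i}) x)"
      if "i \<in> S" for i
    proof -
      have "insert a S - {i} = insert a (S - {i})"
        using that 2 by auto
      then show ?thesis
        using 2 by (simp add: esum_insert algebra_simps)
    qed
    then have "(\<Sum>i\<in>S. x $ i * esum (Suc k') (insert a S - {i}) x)
        = real (Suc (Suc k')) * esum (Suc (Suc k')) S x + x $ a * (real (Suc k') * esum (Suc k') S x)"
      using 2(3)[of k'] k' by (simp add: sum.distrib sum_distrib_left[symmetric])
    moreover have "insert a S - {a} = S" using 2 by auto
    ultimately show ?case
      using 2 by (simp add: esum_insert algebra_simps)
  qed
qed

text \<open>Serves at points where \<open>esum (Suc k) S x\<close> vanishes: if the sums over
  \<open>S - {i}\<close> are nonnegative there, the left side cannot be positive.\<close>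

lemma esum_newton:
  "real (Suc (Suc k)) * esum (Suc (Suc k)) S x
    = (\<Sum>i\<in>S. x $ i) * esum (Suc k) S x - (\<Sum>i\<in>S. (x $ i)\<^sup>2 * esum k (S - {i}) x)"
proof -
  have "real (Suc (Suc k)) * esum (Suc (Suc k)) S x = (\<Sum>i\<in>S. x $ i * esum (Suc k) (S - {i}) x)"
    by (simp add: esum_euler)
  also have "\<dots> = (\<Sum>i\<in>S. x $ i * esum (Suc k) S x - (x $ i)\<^sup>2 * esum k (S - {i}) x)"
    by (intro sum.cong refl) (simp add: esum_remove algebra_simps power2_eq_square)
  finally show ?thesis
    by (simp add: sum_subtractf sum_distrib_right)
qed

lemma esum_one_pos:
  assumes "k \<le> card S"
  shows "esum k S (\<chi> i. 1) > 0"
  using assms by (simp add: esum_def n_subsets)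

lemma continuous_on_esum [continuous_intros]: "continuous_on A (esum k S)"
  unfolding esum_def by (intro continuous_intros)

subsection \<open>A description of the component by inequalities\<close>

text \<open>The bound \<open>j + card T \<le> k\<close> lets membership pass to
  \<open>S - {i}\<close> with \<open>k\<close> lowered by one, matching the recursion over the
  branches of the network.\<close>

definition garding :: "nat \<Rightarrow> 'n::finite set \<Rightarrow> (real^'n) set" where
  "garding k S = {x. \<forall>T j. T \<subseteq> S \<longrightarrow> j + card T \<le> k \<longrightarrow> esum j (S - T) x > 0}"

lemma gardingD: "x \<in> garding k S \<Longrightarrow> T \<subseteq> S \<Longrightarrow> j + card T \<le> k \<Longrightarrow> esum j (S - T) x > 0"
  by (auto simp: garding_def)

lemma garding_remove:
  assumes "x \<in> garding (Suc k) S" "i \<in> S"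
  shows "x \<in> garding k (S - {i})"
proof -
  have "esum j (S - {i} - T) x > 0" if "T \<subseteq> S - {i}" "j + card T \<le> k" for T j
  proof -
    have "i \<notin> T" using that by auto
    then have "esum j (S - insert i T) x > 0"
      using that assms by (intro gardingD[OF assms(1)]) auto
    moreover have "S - insert i T = S - {i} - T" by auto
    ultimately show ?thesis by simp
  qed
  then show ?thesis by (auto simp: garding_def)
qed

lemma open_garding: "open (garding k S)"
proof -
  have "garding k S = (\<Inter>p\<in>{(T, j). T \<subseteq> S \<and> j + card T \<le> k}. {x. 0 < esum (snd p) (S - fst p) x})"
    by (auto simp: garding_def)
  moreover have "finite {(T, j). T \<subseteq> S \<and> j + card T \<le> k}"
    by (rule finite_subset[of _ "Pow S \<times> {..k}"]) auto
  ultimately show ?thesis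
    by (auto intro!: open_INT open_Collect_less continuous_intros)
qed

lemma one_in_garding:
  assumes "k \<le> card S"
  shows "(\<chi> i. 1) \<in> garding k S"
  using assms by (auto simp: garding_def card_Diff_subset intro!: esum_one_pos)

lemma closure_garding_nonneg:
  assumes "x \<in> closure (garding k S)" "T \<subseteq> S" "j + card T \<le> k"
  shows "esum j (S - T) x \<ge> 0"
proof -
  have "closure (garding k S) \<subseteq> {x. 0 \<le> esum j (S - T) x}"
    using assms(2,3)
    by (intro closure_minimal closed_Collect_le continuous_intros) (auto dest: gardingD intro: less_imp_le)
  then show ?thesis using assms(1) by auto
qed

text \<open>One strict inequality forces all of them: by \<open>esum_newton\<close>, a zero in
  degree \<open>k\<close>, over \<open>S\<close> or over \<open>S - {i}\<close>, would make
  \<open>esum (Suc k) S x\<close> nonpositive. So strictness descends to degree \<open>k\<close>,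
  and the induction hypothesis applies to both sets.\<close>

lemma nonneg_imp_garding:
  assumes "\<And>T j. T \<subseteq> S \<Longrightarrow> j + card T \<le> k \<Longrightarrow> esum j (S - T) x \<ge> 0"
    and "esum k S x > 0"
  shows "x \<in> garding k S"
  using assms
proof (induction k arbitrary: S)
  case 0
  then show ?case by (auto simp: garding_def)
next
  case (Suc k)
  have nonneg: "esum j (S - {i} - T) x \<ge> 0" if "i \<in> S" "T \<subseteq> S - {i}" "j + card T \<le> k" for i T j
  proof -
    have "i \<notin> T" using that by auto
    then have "esum j (S - insert i T) x \<ge> 0"
      using that by (intro Suc.prems(1)) auto
    moreover have "S - insert i T = S - {i} - T" by auto
    ultimately show ?thesis by simp
  qed
  have pos: "esum k S x > 0"
  proof (cases k)
    case k: (Suc k')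
    have "esum k S x \<noteq> 0"
    proof
      assume "esum k S x = 0"
      then have "real (Suc k) * esum (Suc k) S x = - (\<Sum>i\<in>S. (x $ i)\<^sup>2 * esum k' (S - {i}) x)"
        unfolding k esum_newton by simp
      moreover have "(\<Sum>i\<in>S. (x $ i)\<^sup>2 * esum k' (S - {i}) x) \<ge> 0"
        using nonneg[of _ "{}" k'] k by (intro sum_nonneg) auto
      ultimately have "real (Suc k) * esum (Suc k) S x \<le> 0" by simp
      then show False using Suc.prems(2) by (auto simp: mult_le_0_iff)
    qed
    then show ?thesis using Suc.prems(1)[of "{}" k] by auto
  qed simp
  have pos_remove: "esum k (S - {i}) x > 0" if "i \<in> S" for i
  proof (cases k)
    case k: (Suc k')
    \<comment> \<open>If this sum vanished, \<open>esum_remove\<close> would give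
      \<open>esum (Suc k) S x = esum (Suc k) (S - {i}) x\<close>, and \<open>esum_newton\<close>
      over \<open>S - {i}\<close> makes the latter nonpositive.\<close>
    have "esum k (S - {i}) x \<noteq> 0"
    proof
      assume 0: "esum k (S - {i}) x = 0"
      then have "real (Suc k) * esum (Suc k) (S - {i}) x
          = - (\<Sum>l\<in>S - {i}. (x $ l)\<^sup>2 * esum k' (S - {i} - {l}) x)"
        unfolding k esum_newton by simp
      moreover have "(\<Sum>l\<in>S - {i}. (x $ l)\<^sup>2 * esum k' (S - {i} - {l}) x) \<ge> 0"
      proof (intro sum_nonneg mult_nonneg_nonneg)
        fix l assume "l \<in> S - {i}"
        then show "esum k' (S - {i} - {l}) x \<ge> 0"
          using nonneg[of i "{l}" k'] k that by auto
      qed auto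
      ultimately have "real (Suc k) * esum (Suc k) (S - {i}) x \<le> 0" by simp
      then show False
        using Suc.prems(2) 0 esum_remove[OF that, of k x] by (auto simp: mult_le_0_iff)
    qed
    then show ?thesis using nonneg[OF that, of "{}" k] by auto
  qed simp
  have "esum j (S - T) x > 0" if T: "T \<subseteq> S" "j + card T \<le> Suc k" for T j
  proof (cases "T = {}")
    case True
    show ?thesis
    proof (cases "j = Suc k")
      case False
      have "x \<in> garding k S"
        using pos by (intro Suc.IH Suc.prems(1)) auto
      from gardingD[OF this, of "{}" j] show ?thesis
        using True False T by auto
    qed (use True Suc.prems in auto)
  next
    case False
    then obtain i where i: "i \<in> T" by auto
    have "x \<in> garding k (S - {i})"
      using pos_remove nonneg i T by (intro Suc.IH) auto
    moreover have "T - {i} \<subseteq> S - {i}" "j + card (T - {i}) \<le> k"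
      using T i card_Suc_Diff1[of T i] by auto
    ultimately have "esum j (S - {i} - (T - {i})) x > 0"
      by (rule gardingD)
    moreover have "S - {i} - (T - {i}) = S - T" using i by auto
    ultimately show ?thesis by simp
  qed
  then show ?case by (auto simp: garding_def)
qed

text \<open>The part of the component inside \<open>garding k UNIV\<close> is relatively open and
  closed: at a limit point the inequalities hold weakly, and \<open>esum k UNIV x \<noteq> 0\<close>
  makes them strict.\<close>

lemma component_subset_garding:
  assumes "k \<le> CARD('n::finite)"
  shows "connected_component_set {x::real^'n. esum k UNIV x \<noteq> 0} (\<chi> i. 1) \<subseteq> garding k UNIV"
    (is "?C \<subseteq> ?G")
proof -
  have one: "(\<chi> i. 1) \<in> ?C"
    using esum_one_pos[OF assms] by (auto simp: connected_component_refl_eq)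
  have "?C \<inter> closure ?G \<subseteq> ?G"
  proof
    fix x assume x: "x \<in> ?C \<inter> closure ?G"
    then have "esum k UNIV x \<noteq> 0"
      using connected_component_subset by blast
    moreover have nonneg: "T \<subseteq> UNIV \<Longrightarrow> j + card T \<le> k \<Longrightarrow> esum j (UNIV - T) x \<ge> 0" for T j
      using x closure_garding_nonneg by blast
    ultimately have "esum k UNIV x > 0"
      using nonneg[of "{}" k] by auto
    then show "x \<in> ?G" using nonneg by (intro nonneg_imp_garding) auto
  qed
  then have eq: "?C \<inter> ?G = ?C \<inter> closure ?G"
    using closure_subset by blast
  have "openin (top_of_set ?C) (?C \<inter> ?G)"
    by (intro openin_open_Int open_garding)
  moreover have "closedin (top_of_set ?C) (?C \<inter> ?G)"
    unfolding eq by (intro closedin_closed_Int closed_closure)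
  ultimately have "?C \<inter> ?G = {} \<or> ?C \<inter> ?G = ?C"
    using connected_connected_component connected_clopen by blast
  then show ?thesis
    using one one_in_garding[OF assms] by blast
qed

subsection \<open>The energy form of the network\<close>

text \<open>Energy of the potential \<open>u\<close> in a tree-like electrical network. Its vertices are the lists of
  distinct elements of \<open>S\<close>, the edge from \<open>l\<close> to \<open>l @ [i]\<close> has conductance
  \<open>x $ i / (k (k - 1) \<dots> (k - length l))\<close>, and the vertices of length \<open>k\<close> are grounded.\<close>

primrec energy :: "real^'n::finite \<Rightarrow> nat \<Rightarrow> 'n set \<Rightarrow> ('n list \<Rightarrow> real) \<Rightarrow> ('n list \<Rightarrow> real) \<Rightarrow> real" where
  "energy x 0 S u w = 0"
| "energy x (Suc k) S u w =
    (\<Sum>i\<in>S. x $ i * (u [] - u [i]) * (w [] - w [i])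
      + energy x k (S - {i}) (\<lambda>l. u (i # l)) (\<lambda>l. w (i # l))) / real (Suc k)"

text \<open>These are the vertices that are not grounded; they will index the rows and columns of
  the matrices.\<close>

definition nodes :: "nat \<Rightarrow> 'n set \<Rightarrow> 'n list set" where
  "nodes k S = {l. distinct l \<and> set l \<subseteq> S \<and> length l < k}"

text \<open>Vanishing outside the tree as well makes a potential the same thing as its finitely many
  values on \<open>nodes k S\<close>.\<close>

definition potential :: "nat \<Rightarrow> 'n set \<Rightarrow> ('n list \<Rightarrow> real) \<Rightarrow> bool" where
  "potential k S u \<longleftrightarrow> (\<forall>l. l \<notin> nodes k S \<longrightarrow> u l = 0)"

lemma nodes_Nil [simp]: "[] \<in> nodes (Suc k) S"
  by (simp add: nodes_def)

lemma nodes_0 [simp]: "nodes 0 S = {}"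
  by (simp add: nodes_def)

lemma nodes_Cons [simp]: "i # l \<in> nodes (Suc k) S \<longleftrightarrow> i \<in> S \<and> l \<in> nodes k (S - {i})"
  by (auto simp: nodes_def)

lemma finite_nodes: "finite (nodes k (S::'n::finite set))"
proof (rule finite_subset)
  show "nodes k S \<subseteq> {l. set l \<subseteq> UNIV \<and> length l \<le> k}"
    by (auto simp: nodes_def)
  show "finite {l. set l \<subseteq> (UNIV::'n set) \<and> length l \<le> k}"
    by (rule finite_lists_length_le) simp
qed

lemma potential_Cons: "potential (Suc k) S u \<Longrightarrow> potential k (S - {i}) (\<lambda>l. u (i # l))"
  by (auto simp: potential_def)

lemma energy_sym: "energy x k S u w = energy x k S w u"
proof (induction k arbitrary: S u w)
  case 0
  then show ?case by simp
next
  case (Suc k)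
  have "energy x k (S - {i}) (\<lambda>l. u (i # l)) (\<lambda>l. w (i # l))
      = energy x k (S - {i}) (\<lambda>l. w (i # l)) (\<lambda>l. u (i # l))" for i
    by (rule Suc.IH)
  then show ?case
    by (simp add: mult_ac)
qed

lemma energy_sum_left:
  "energy x k S (\<lambda>l. \<Sum>a\<in>A. v a * f a l) w = (\<Sum>a\<in>A. v a * energy x k S (f a) w)"
proof (induction k arbitrary: S f w)
  case 0
  then show ?case by simp
next
  case (Suc k)
  let ?t = "\<lambda>a i. x $ i * (f a [] - f a [i]) * (w [] - w [i])
      + energy x k (S - {i}) (\<lambda>l. f a (i # l)) (\<lambda>l. w (i # l))"
  have "x $ i * ((\<Sum>a\<in>A. v a * f a []) - (\<Sum>a\<in>A. v a * f a [i])) * (w [] - w [i])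
      = (\<Sum>a\<in>A. v a * (x $ i * (f a [] - f a [i]) * (w [] - w [i])))" for i
    unfolding sum_subtractf[symmetric] sum_distrib_left sum_distrib_right
    by (intro sum.cong refl) (simp add: algebra_simps)
  then have "energy x (Suc k) S (\<lambda>l. \<Sum>a\<in>A. v a * f a l) w = (\<Sum>i\<in>S. \<Sum>a\<in>A. v a * ?t a i) / real (Suc k)"
    by (simp only: energy.simps Suc.IH sum.distrib[symmetric] distrib_left)
  also have "(\<Sum>i\<in>S. \<Sum>a\<in>A. v a * ?t a i) = (\<Sum>a\<in>A. v a * (\<Sum>i\<in>S. ?t a i))"
    by (subst sum.swap) (simp only: sum_distrib_left)
  finally show ?case
    by (simp only: energy.simps sum_divide_distrib[of _ A] times_divide_eq_right)
qed

lemma energy_linear: "energy (s *\<^sub>R x + t *\<^sub>R y) k S u w = s * energy x k S u w + t * energy y k S u w"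
proof (induction k arbitrary: S u w)
  case 0
  then show ?case by simp
next
  case (Suc k)
  have "(s *\<^sub>R x + t *\<^sub>R y) $ i * p * q + (s * d + t * e) = s * (x $ i * p * q + d) + t * (y $ i * p * q + e)"
    for i p q d e by (simp add: algebra_simps)
  then show ?case
    by (simp only: energy.simps Suc.IH times_divide_eq_right sum_distrib_left
        add_divide_distrib[symmetric] sum.distrib[symmetric])
qed

text \<open>Writes the form as a linear pencil in \<open>x\<close>; the coefficient forms will
  become the matrices \<open>A i\<close>.\<close>

lemma energy_axis_expansion: "energy x k S u w = (\<Sum>i\<in>UNIV. x $ i * energy (axis i 1) k S u w)"
proof -
  have "linear (\<lambda>x. energy x k S u w)"
    using energy_linear[of 1 _ 1] energy_linear[of _ _ 0] by (intro linearI) auto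
  then have "energy (\<Sum>i\<in>UNIV. x $ i *\<^sub>R axis i 1) k S u w = (\<Sum>i\<in>UNIV. x $ i * energy (axis i 1) k S u w)"
    by (simp add: linear_sum[of "\<lambda>x. energy x k S u w"] linear_cmul[of "\<lambda>x. energy x k S u w"])
  moreover have "(\<Sum>i\<in>UNIV. x $ i *\<^sub>R axis i 1) = x"
    using basis_expansion[of x] by (simp add: scalar_mult_eq_scaleR)
  ultimately show ?thesis by simp
qed

lemma energy_scale: "energy x k S (\<lambda>l. c * u l) (\<lambda>l. c * u l) = c\<^sup>2 * energy x k S u u"
proof -
  have "energy x k S (\<lambda>l. c * u l) w = c * energy x k S u w" for w
    using energy_sum_left[of x k S "\<lambda>_. c" "\<lambda>_. u" "{()}"] by simp
  from this[of "\<lambda>l. c * u l"] this[of u] show ?thesis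
    by (simp add: energy_sym[of x k S u "\<lambda>l. c * u l"] power2_eq_square)
qed

lemma energy_zero: "energy x k S (\<lambda>l. 0) (\<lambda>l. 0) = 0"
  by (induction k arbitrary: S) auto

text \<open>Minimising over \<open>v\<close>: a conductance \<open>a\<close> in series with a conductance \<open>r\<close>.\<close>

lemma series_conductance:
  fixes a r u v :: real
  assumes "a + r \<noteq> 0"
  shows "a * (u - v)\<^sup>2 + r * v\<^sup>2 = a * r / (a + r) * u\<^sup>2 + (a + r) * (v - a / (a + r) * u)\<^sup>2"
proof -
  define c where "c = a / (a + r)"
  define s where "s = a + r"
  have "a = c * s" "r = s - c * s" "s \<noteq> 0"
    using assms by (auto simp: c_def s_def)
  then have "a * r / s = c * r" by simp
  moreover have "a * (u - v)\<^sup>2 + r * v\<^sup>2 = c * r * u\<^sup>2 + s * (v - c * u)\<^sup>2"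
    unfolding \<open>a = c * s\<close> \<open>r = s - c * s\<close> by (simp add: algebra_simps power2_eq_square)
  ultimately show ?thesis
    by (simp only: c_def s_def)
qed

subsection \<open>Effective conductances\<close>

lemma esum_add_ratio:
  assumes "i \<in> S" "esum k (S - {i}) x \<noteq> 0"
  shows "x $ i + esum (Suc k) (S - {i}) x / esum k (S - {i}) x = esum (Suc k) S x / esum k (S - {i}) x"
  using assms by (simp add: esum_remove[OF assms(1)] field_simps)

text \<open>By \<open>esum_add_ratio\<close> the branch at \<open>i\<close> has conductance
  \<open>x $ i * esum (Suc k) (S - {i}) x / esum (Suc k) S x\<close>; parallel branches add up, and
  \<open>esum_euler\<close> evaluates the sum.\<close>

lemma sum_series_conductances:
  assumes "esum (Suc k) S x \<noteq> 0" "\<And>i. i \<in> S \<Longrightarrow> esum k (S - {i}) x \<noteq> 0"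
  shows "(\<Sum>i\<in>S. let r = esum (Suc k) (S - {i}) x / esum k (S - {i}) x in x $ i * r / (x $ i + r))
    = real (Suc (Suc k)) * (esum (Suc (Suc k)) S x / esum (Suc k) S x)"
proof -
  have "(\<Sum>i\<in>S. let r = esum (Suc k) (S - {i}) x / esum k (S - {i}) x in x $ i * r / (x $ i + r))
      = (\<Sum>i\<in>S. x $ i * esum (Suc k) (S - {i}) x / esum (Suc k) S x)"
    using assms by (intro sum.cong refl) (simp add: Let_def esum_add_ratio)
  then show ?thesis
    by (simp only: esum_euler times_divide_eq_right sum_divide_distrib[symmetric])
qed

text \<open>Minimisation branch by branch: induction bounds the energy beyond \<open>[i]\<close> by
  \<open>r i * (u [i])\<^sup>2\<close>, and completing the square in \<open>u [i]\<close> leaves the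
  series conductance.\<close>

lemma energy_ge:
  assumes "x \<in> garding (Suc k) S" "potential (Suc k) S u"
  shows "energy x (Suc k) S u u \<ge> esum (Suc k) S x / esum k S x * (u [])\<^sup>2"
  using assms
proof (induction k arbitrary: S u)
  case 0
  \<comment> \<open>Only the root is not grounded in this case.\<close>
  then have "u [i] = 0" for i
    by (auto simp: potential_def)
  then show ?case
    by (simp add: esum_1 sum_distrib_right power2_eq_square mult.assoc)
next
  case (Suc k)
  define r where "r i = esum (Suc k) (S - {i}) x / esum k (S - {i}) x" for i
  have pos: "esum (Suc k) S x > 0" "i \<in> S \<Longrightarrow> esum k (S - {i}) x > 0" for i
    using gardingD[OF Suc.prems(1), of "{}" "Suc k"] gardingD[OF Suc.prems(1), of "{i}" k] by auto
  have "x $ i * r i / (x $ i + r i) * (u [])\<^sup>2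
      \<le> x $ i * (u [] - u [i]) * (u [] - u [i]) + energy x (Suc k) (S - {i}) (\<lambda>l. u (i # l)) (\<lambda>l. u (i # l))"
    if i: "i \<in> S" for i
  proof -
    have "x $ i + r i > 0"
      using i pos(1) pos(2)[of i] by (simp add: r_def esum_add_ratio)
    then have "x $ i * r i / (x $ i + r i) * (u [])\<^sup>2 \<le> x $ i * (u [] - u [i])\<^sup>2 + r i * (u [i])\<^sup>2"
      by (subst series_conductance) auto
    moreover have "r i * (u [i])\<^sup>2 \<le> energy x (Suc k) (S - {i}) (\<lambda>l. u (i # l)) (\<lambda>l. u (i # l))"
      unfolding r_def
      using i Suc.prems by (intro Suc.IH garding_remove potential_Cons)
    ultimately show ?thesis
      by (simp only: power2_eq_square mult.assoc)
  qed
  then have "(\<Sum>i\<in>S. x $ i * r i / (x $ i + r i)) * (u [])\<^sup>2 \<le> real (Suc (Suc k)) * energy x (Suc (Suc k)) S u u"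
    unfolding sum_distrib_right energy.simps(2)[of x "Suc k"] by (simp add: sum_mono del: energy.simps)
  moreover have "(\<Sum>i\<in>S. x $ i * r i / (x $ i + r i)) = real (Suc (Suc k)) * (esum (Suc (Suc k)) S x / esum (Suc k) S x)"
    using sum_series_conductances[of k S x] pos unfolding r_def Let_def by force
  ultimately have "real (Suc (Suc k)) * (esum (Suc (Suc k)) S x / esum (Suc k) S x * (u [])\<^sup>2)
      \<le> real (Suc (Suc k)) * energy x (Suc (Suc k)) S u u"
    by (simp only: mult.assoc)
  then show ?case
    by (rule mult_left_le_imp_le) simp
qed

text \<open>The bound \<open>energy_ge\<close> has a positive factor, so the root value is zero.
  Then every branch contributes a nonnegative amount, hence nothing, and the induction hypothesis
  applies to each branch.\<close>

lemma energy_eq_0_imp: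
  assumes "x \<in> garding (Suc k) S" "potential (Suc k) S u" "energy x (Suc k) S u u = 0"
  shows "u l = 0"
  using assms
proof (induction k arbitrary: S u l)
  case (0 S u l)
  have "esum (Suc 0) S x > 0"
    using gardingD[OF 0(1), of "{}" "Suc 0"] by simp
  then have "u [] = 0"
    using energy_ge[OF 0(1,2)] 0(3) by (simp add: mult_le_0_iff)
  then show ?case
    using 0(2) by (cases l) (auto simp: potential_def)
next
  case (Suc k S u l)
  define r where "r i = esum (Suc k) (S - {i}) x / esum k (S - {i}) x" for i
  define t where "t i = x $ i * (u [] - u [i]) * (u [] - u [i])
    + energy x (Suc k) (S - {i}) (\<lambda>l. u (i # l)) (\<lambda>l. u (i # l))" for i
  have pos: "esum (Suc (Suc k)) S x > 0" "esum (Suc k) S x > 0" "i \<in> S \<Longrightarrow> esum k (S - {i}) x > 0" for i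
    using gardingD[OF Suc.prems(1), of "{}" "Suc k"] gardingD[OF Suc.prems(1), of "{}" "Suc (Suc k)"]
      gardingD[OF Suc.prems(1), of "{i}" k] by auto
  define R where "R = esum (Suc (Suc k)) S x / esum (Suc k) S x"
  have "R * (u [])\<^sup>2 \<le> 0"
    using energy_ge[OF Suc.prems(1,2)] Suc.prems(3) by (simp only: R_def)
  moreover have "R > 0"
    using pos by (simp add: R_def)
  ultimately have root: "u [] = 0"
    by (simp add: mult_le_0_iff)
  have sum0: "(\<Sum>i\<in>S. t i) = 0"
    using Suc.prems(3) unfolding energy.simps(2)[of x "Suc k"] t_def by simp
  have rpos: "x $ i + r i > 0" if "i \<in> S" for i
    using that pos(2) pos(3)[of i] by (simp add: r_def esum_add_ratio)
  \<comment> \<open>With the root at zero, the edge to \<open>[i]\<close> contributes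
    \<open>x $ i * (u [i])\<^sup>2\<close>, and \<open>energy_ge\<close> bounds the rest of the
    branch.\<close>
  have t_ge: "(x $ i + r i) * (u [i])\<^sup>2 \<le> t i" if i: "i \<in> S" for i
  proof -
    have "r i * (u [i])\<^sup>2 \<le> energy x (Suc k) (S - {i}) (\<lambda>l. u (i # l)) (\<lambda>l. u (i # l))"
      unfolding r_def
      using i Suc.prems by (intro energy_ge garding_remove potential_Cons)
    then show ?thesis
      unfolding t_def root distrib_right by (simp add: power2_eq_square mult.assoc)
  qed
  have t_nonneg: "t i \<ge> 0" if "i \<in> S" for i
    using t_ge[OF that] rpos[OF that] by (meson less_imp_le mult_nonneg_nonneg order_trans zero_le_power2)
  have t0: "t i = 0" if "i \<in> S" for i
    using sum0 t_nonneg that by (simp add: sum_nonneg_eq_0_iff)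
  show ?case
  proof (cases l)
    case Nil
    then show ?thesis using root by simp
  next
    case (Cons i l')
    show ?thesis
    proof (cases "i \<in> S")
      case False
      then show ?thesis
        using Suc.prems(2) Cons by (auto simp: potential_def)
    next
      case True
      have "u [i] = 0"
        using t_ge[OF True] rpos[OF True] t0[OF True] by (simp add: mult_le_0_iff)
      then have "energy x (Suc k) (S - {i}) (\<lambda>l. u (i # l)) (\<lambda>l. u (i # l)) = 0"
        using t0[OF True] root unfolding t_def by simp
      then show ?thesis
        using Suc.IH[of "S - {i}" "\<lambda>l. u (i # l)" l'] Suc.prems True Cons
        by (simp add: garding_remove potential_Cons del: energy.simps)
    qed
  qed
qed

lemma energy_pos:
  assumes "x \<in> garding (Suc k) S" "potential (Suc k) S u" "u l \<noteq> 0"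
  shows "energy x (Suc k) S u u > 0"
proof -
  have "esum (Suc k) S x > 0" "esum k S x > 0"
    using gardingD[OF assms(1), of "{}" k] gardingD[OF assms(1), of "{}" "Suc k"] by auto
  then have "0 \<le> esum (Suc k) S x / esum k S x * (u [])\<^sup>2" by simp
  also have "\<dots> \<le> energy x (Suc k) S u u"
    using assms(1,2) by (rule energy_ge)
  finally have "0 \<le> energy x (Suc k) S u u" .
  moreover have "energy x (Suc k) S u u \<noteq> 0"
    using energy_eq_0_imp[OF assms(1,2), of l] assms(3) by blast
  ultimately show ?thesis by (rule le_neq_trans[OF _ not_sym])
qed

text \<open>Extends a potential on the branch at \<open>[i]\<close> by zero. The result vanishes at
  the root, so positivity assumed for such potentials can be tested on single branches.\<close>

definition graft :: "'n \<Rightarrow> ('n list \<Rightarrow> real) \<Rightarrow> 'n list \<Rightarrow> real" where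
  "graft i w l = (case l of [] \<Rightarrow> 0 | j # l' \<Rightarrow> if j = i then w l' else 0)"

lemma graft_simps [simp]: "graft i w [] = 0" "graft i w (j # l) = (if j = i then w l else 0)"
  by (simp_all add: graft_def)

lemma potential_graft:
  assumes "i \<in> S" "potential k (S - {i}) w"
  shows "potential (Suc k) S (graft i w)"
  unfolding potential_def
proof (intro allI impI)
  fix l assume "l \<notin> nodes (Suc k) S"
  then show "graft i w l = 0"
    using assms by (cases l) (auto simp: potential_def)
qed

lemma energy_graft:
  assumes "i \<in> S"
  shows "energy x (Suc k) S (graft i w) (graft i w)
    = (x $ i * (w [])\<^sup>2 + energy x k (S - {i}) w w) / real (Suc k)"
proof -
  have "(\<Sum>j\<in>S. x $ j * (graft i w [] - graft i w [j]) * (graft i w [] - graft i w [j])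
      + energy x k (S - {j}) (\<lambda>l. graft i w (j # l)) (\<lambda>l. graft i w (j # l)))
    = (\<Sum>j\<in>S. if j = i then x $ i * (w [])\<^sup>2 + energy x k (S - {i}) w w else 0)"
    by (intro sum.cong refl) (simp add: energy_zero power2_eq_square)
  then show ?thesis
    using assms by (simp add: sum.delta)
qed

text \<open>The vector \<open>u\<close> is the harmonic potential. Positive definiteness on the complement of the root
  is what guarantees that no denominator met in its recursive construction vanishes.\<close>

lemma harmonic_potential:
  assumes "Suc k \<le> card S"
    and "\<And>w l. potential (Suc k) S w \<Longrightarrow> w [] = 0 \<Longrightarrow> w l \<noteq> 0 \<Longrightarrow> energy x (Suc k) S w w > 0"
  shows "esum k S x \<noteq> 0 \<and>
    (\<exists>u. potential (Suc k) S u \<and> u [] = 1 \<and> energy x (Suc k) S u u = esum (Suc k) S x / esum k S x)"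
  using assms
proof (induction k arbitrary: S)
  case 0
  define u :: "'a list \<Rightarrow> real" where "u l = (if l = [] then 1 else 0)" for l
  have "potential (Suc 0) S u" "u [] = 1" "energy x (Suc 0) S u u = esum (Suc 0) S x / esum 0 S x"
    by (auto simp: potential_def u_def nodes_def esum_1)
  then show ?case by auto
next
  case (Suc k)
  define r where "r i = esum (Suc k) (S - {i}) x / esum k (S - {i}) x" for i
  \<comment> \<open>Grafting carries the positivity hypothesis from the whole tree to the branch at
    \<open>i\<close>.\<close>
  have sub: "esum k (S - {i}) x \<noteq> 0 \<and>
      (\<exists>u. potential (Suc k) (S - {i}) u \<and> u [] = 1 \<and> energy x (Suc k) (S - {i}) u u = r i)"
    if i: "i \<in> S" for i
    unfolding r_def
  proof (rule Suc.IH)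
    show "Suc k \<le> card (S - {i})"
      using Suc.prems(1) i by simp
    fix w l assume w: "potential (Suc k) (S - {i}) w" "w [] = 0" "w l \<noteq> 0"
    have "energy x (Suc (Suc k)) S (graft i w) (graft i w) > 0"
      using w by (intro Suc.prems(2)[of _ "i # l"] potential_graft[OF i]) auto
    then show "energy x (Suc k) (S - {i}) w w > 0"
      unfolding energy_graft[OF i] using w(2) by (simp add: zero_less_divide_iff del: energy.simps)
  qed
  then obtain h where h: "\<And>i. i \<in> S \<Longrightarrow> potential (Suc k) (S - {i}) (h i)" "\<And>i. i \<in> S \<Longrightarrow> h i [] = 1"
    "\<And>i. i \<in> S \<Longrightarrow> energy x (Suc k) (S - {i}) (h i) (h i) = r i"
    by metis
  \<comment> \<open>The grafted \<open>h i\<close> has value 1 at \<open>[i]\<close>, so its energy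
    is \<open>x $ i + r i\<close> up to a positive factor.\<close>
  have rpos: "x $ i + r i > 0" if i: "i \<in> S" for i
  proof -
    have "energy x (Suc (Suc k)) S (graft i (h i)) (graft i (h i)) > 0"
      using h i by (intro Suc.prems(2)[of _ "[i]"] potential_graft[OF i]) auto
    then show ?thesis
      unfolding energy_graft[OF i] using h[OF i] by (simp add: zero_less_divide_iff del: energy.simps)
  qed
  have nz: "esum (Suc k) S x \<noteq> 0"
  proof -
    have "S \<noteq> {}" using Suc.prems(1) by auto
    then obtain i where i: "i \<in> S" by blast
    then show ?thesis
      using rpos[OF i] sub[OF i] by (auto simp: r_def esum_add_ratio)
  qed
  \<comment> \<open>Voltage divider: the factor of \<open>h i\<close> is the minimising value at
    \<open>[i]\<close> in \<open>series_conductance\<close> when the root has value 1.\<close>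
  define u where "u l = (case l of [] \<Rightarrow> 1 | i # l' \<Rightarrow> if i \<in> S then x $ i / (x $ i + r i) * h i l' else 0)" for l
  have u: "u [] = 1" "i \<in> S \<Longrightarrow> u (i # l) = x $ i / (x $ i + r i) * h i l" for i l
    by (auto simp: u_def)
  have "potential (Suc (Suc k)) S u"
    unfolding potential_def
  proof (intro allI impI)
    fix l assume "l \<notin> nodes (Suc (Suc k)) S"
    then show "u l = 0"
      using h(1) by (cases l) (auto simp: potential_def u_def)
  qed
  moreover have "energy x (Suc (Suc k)) S u u = esum (Suc (Suc k)) S x / esum (Suc k) S x"
  proof -
    have "x $ i * (u [] - u [i]) * (u [] - u [i]) + energy x (Suc k) (S - {i}) (\<lambda>l. u (i # l)) (\<lambda>l. u (i # l))
        = x $ i * r i / (x $ i + r i)" if i: "i \<in> S" for i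
    proof -
      define c where "c = x $ i / (x $ i + r i)"
      have "x $ i * (1 - c)\<^sup>2 + r i * c\<^sup>2 = x $ i * r i / (x $ i + r i)"
        using series_conductance[of "x $ i" "r i" 1 c] rpos[OF i] by (simp add: c_def)
      moreover have "energy x (Suc k) (S - {i}) (\<lambda>l. u (i # l)) (\<lambda>l. u (i # l)) = c\<^sup>2 * r i"
        using i by (simp only: u energy_scale h c_def)
      moreover have "u [i] = c"
        using i by (simp add: u h c_def)
      ultimately show ?thesis
        by (simp add: u(1) power2_eq_square algebra_simps del: energy.simps)
    qed
    then have "energy x (Suc (Suc k)) S u u = (\<Sum>i\<in>S. x $ i * r i / (x $ i + r i)) / real (Suc (Suc k))"
      by (simp only: energy.simps(2)[of x "Suc k"] cong: sum.cong)
    also have "(\<Sum>i\<in>S. x $ i * r i / (x $ i + r i)) = real (Suc (Suc k)) * (esum (Suc (Suc k)) S x / esum (Suc k) S x)"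
      using sum_series_conductances[of k S x] nz sub unfolding r_def Let_def by blast
    finally show ?thesis by (simp del: of_nat_Suc)
  qed
  ultimately show ?case
    using nz u(1) by blast
qed

subsection \<open>The spectrahedral representation\<close>

theorem theorem1:
  fixes k :: nat
  assumes "1 \<le> k" and "k \<le> CARD('n::finite)"
  shows "spectrahedral (hyperbolicity_cone (esym k :: real^'n \<Rightarrow> real) (\<chi> i. 1))"
proof -
  obtain k' where k: "k = Suc k'"
    using assms(1) by (cases k) auto
  define m where "m = card (nodes k (UNIV :: 'n set))"
  obtain g where g: "bij_betw g {0..<m} (nodes k (UNIV :: 'n set))"
    using ex_bij_betw_nat_finite[OF finite_nodes] unfolding m_def by blast
  \<comment> \<open>The \<open>d a\<close> are the unit potentials at the enumerated vertices, and
    \<open>A i\<close> is the Gram matrix of the energy form at the \<open>i\<close>-th unit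
    vector.\<close>
  define d :: "nat \<Rightarrow> 'n list \<Rightarrow> real" where "d a l = of_bool (l = g a)" for a l
  define A where "A i a b = energy (axis i 1) k UNIV (d a) (d b)" for i a b
  define pot where "pot v = (\<lambda>l. \<Sum>a<m. v a * d a l)" for v
  define E where "E x v = energy x k UNIV (pot v) (pot v)" for x v

  have form: "(\<Sum>a<m. \<Sum>b<m. v a * (\<Sum>i\<in>UNIV. x $ i * A i a b) * v b) = E x v" for x v
  proof -
    have "E x v = (\<Sum>a<m. v a * energy x k UNIV (pot v) (d a))"
      unfolding E_def by (subst (1) pot_def) (simp only: energy_sum_left energy_sym[of x k UNIV "pot v"])
    also have "\<dots> = (\<Sum>a<m. v a * (\<Sum>b<m. v b * energy x k UNIV (d b) (d a)))"
      unfolding pot_def energy_sum_left ..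
    also have "\<dots> = (\<Sum>a<m. \<Sum>b<m. v a * energy x k UNIV (d a) (d b) * v b)"
      unfolding sum_distrib_left
      by (intro sum.cong refl) (metis energy_sym mult.assoc mult.commute)
    finally show ?thesis
      by (simp only: A_def energy_axis_expansion[of x])
  qed
  have pot_g: "pot v (g a) = v a" if "a < m" for v a
  proof -
    have "g a = g b \<longleftrightarrow> b = a" if "b < m" for b
      using g \<open>a < m\<close> that by (auto simp: bij_betw_def inj_on_def)
    then have "pot v (g a) = (\<Sum>b<m. if b = a then v b else 0)"
      unfolding pot_def d_def by (intro sum.cong) auto
    then show ?thesis using that by simp
  qed
  have g_surj: thesis if "l \<in> nodes k UNIV" "\<And>a. a < m \<Longrightarrow> l = g a \<Longrightarrow> thesis" for l thesis
  proof -
    have "l \<in> g ` {0..<m}"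
      using that(1) g by (simp add: bij_betw_def)
    then show thesis using that(2) by auto
  qed
  have potential_pot: "potential k UNIV (pot v)" for v
    unfolding potential_def pot_def
  proof (intro allI impI sum.neutral ballI)
    fix l a assume "l \<notin> nodes k (UNIV :: 'n set)" "a \<in> {..<m}"
    then have "l \<noteq> g a"
      using g by (auto simp: bij_betw_def)
    then show "v a * d a l = 0" by (simp add: d_def)
  qed
  \<comment> \<open>Definiteness of the matrix thereby speaks about all potentials, in particular
    the harmonic one.\<close>
  have pot_surj: "u = pot (\<lambda>a. u (g a))" if u: "potential k UNIV u" for u
  proof
    fix l
    show "u l = pot (\<lambda>a. u (g a)) l"
    proof (cases "l \<in> nodes k UNIV")
      case True
      then obtain a where "a < m" "l = g a"
        by (rule g_surj)
      then show ?thesis by (simp add: pot_g)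
    next
      case False
      then show ?thesis
        using u potential_pot by (simp add: potential_def)
    qed
  qed
  have E_linear: "E (s *\<^sub>R x + t *\<^sub>R y) v = s * E x v + t * E y v" for s t x y v
    by (simp add: E_def energy_linear)

  define C where "C = connected_component_set {x::real^'n. esum k UNIV x \<noteq> 0} (\<chi> i. 1)"
  define P where "P = {x. \<forall>v. (\<exists>a<m. v a \<noteq> 0) \<longrightarrow> E x v > 0}"
  define K where "K = {x. \<forall>v. E x v \<ge> 0}"

  have garding_P: "garding k UNIV \<subseteq> P"
  proof
    fix x :: "real^'n" assume x: "x \<in> garding k UNIV"
    have "E x v > 0" if "a < m" "v a \<noteq> 0" for v a
      using energy_pos[of x k' UNIV "pot v" "g a"] x potential_pot[of v] that
      by (simp add: k E_def pot_g del: energy.simps)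
    then show "x \<in> P" by (auto simp: P_def)
  qed
  have one_P: "(\<chi> i. 1) \<in> P"
    using garding_P one_in_garding[of k UNIV] assms(2) by auto
  \<comment> \<open>The harmonic potential has value 1 at the root, so it is nonzero and its energy,
    the quotient of consecutive sums, is positive.\<close>
  have P_nz: "esum k UNIV x \<noteq> 0" if x: "x \<in> P" for x
  proof -
    have pos: "energy x (Suc k') UNIV w w > 0" if w: "potential (Suc k') UNIV w" "w l \<noteq> 0" for w l
    proof -
      have "l \<in> nodes k UNIV"
        using w by (auto simp: potential_def k)
      then obtain a where "a < m" "l = g a"
        by (rule g_surj)
      then have "E x (\<lambda>a. w (g a)) > 0"
        using x w by (auto simp: P_def)
      then show ?thesis
        using pot_surj[of w] w(1) unfolding E_def k by simp
    qed
    have "\<exists>u. potential (Suc k') UNIV u \<and> u [] = 1 \<and>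
        energy x (Suc k') UNIV u u = esum (Suc k') UNIV x / esum k' UNIV x"
      using harmonic_potential[of k' UNIV x] pos assms(2) unfolding k by blast
    then obtain u where "potential (Suc k') UNIV u" "u [] = 1"
      "energy x (Suc k') UNIV u u = esum (Suc k') UNIV x / esum k' UNIV x" by blast
    then have "esum (Suc k') UNIV x / esum k' UNIV x > 0"
      using pos[of u "[]"] by simp
    then show ?thesis by (auto simp: k)
  qed
  have "convex P"
    unfolding convex_def
  proof (intro ballI allI impI)
    fix x y and s t :: real
    assume xy: "x \<in> P" "y \<in> P" and st: "0 \<le> s" "0 \<le> t" "s + t = 1"
    have "s * E x v + t * E y v > 0" if "\<exists>a<m. v a \<noteq> 0" for v
    proof -
      have "E x v > 0" "E y v > 0"
        using xy that by (auto simp: P_def)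
      then show ?thesis
        using st by (cases "s = 0") (auto intro: add_pos_nonneg)
    qed
    then show "s *\<^sub>R x + t *\<^sub>R y \<in> P"
      by (auto simp: P_def E_linear)
  qed
  \<comment> \<open>A convex set is connected, and \<open>P\<close> contains the all-ones vector and
    avoids the zeros of \<open>esum k UNIV\<close>.\<close>
  then have "P \<subseteq> C"
    unfolding C_def using one_P P_nz
    by (intro connected_component_maximal convex_connected) auto
  moreover have "C \<subseteq> P"
    using component_subset_garding[OF assms(2)] garding_P unfolding C_def by blast
  ultimately have "C = P" by blast

  have "closed K"
  proof -
    have "closed {x. E x v \<ge> 0}" for v
      unfolding E_def by (subst energy_axis_expansion) (intro closed_Collect_le continuous_intros)
    then show ?thesis
      unfolding K_def by (intro closed_Collect_all)
  qed
  moreover have "P \<subseteq> K"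
  proof
    fix x assume x: "x \<in> P"
    have "E x v \<ge> 0" for v
    proof (cases "\<exists>a<m. v a \<noteq> 0")
      case True
      then show ?thesis using x by (auto simp: P_def intro: less_imp_le)
    next
      case False
      then have "pot v = (\<lambda>l. 0)"
        by (auto simp: pot_def)
      then show ?thesis by (simp add: E_def energy_zero)
    qed
    then show "x \<in> K" by (simp add: K_def)
  qed
  ultimately have "closure P \<subseteq> K"
    by (simp add: closure_minimal)
  moreover have "K \<subseteq> closure P"
  proof
    fix x assume x: "x \<in> K"
    \<comment> \<open>A semidefinite form plus a positive multiple of the definite form at the
      all-ones vector is definite.\<close>
    have "1 *\<^sub>R x + inverse (real (Suc n)) *\<^sub>R (\<chi> i. 1) \<in> P" for n
      using x one_P unfolding P_def mem_Collect_eq E_linear K_def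
      by (auto intro!: add_nonneg_pos mult_pos_pos)
    moreover have "(\<lambda>n. 1 *\<^sub>R x + inverse (real (Suc n)) *\<^sub>R (\<chi> i. 1)) \<longlonglongrightarrow> 1 *\<^sub>R x + 0 *\<^sub>R (\<chi> i. 1)"
      by (intro tendsto_intros LIMSEQ_inverse_real_of_nat)
    ultimately show "x \<in> closure P"
      unfolding closure_sequential by force
  qed
  ultimately have cone: "hyperbolicity_cone (esym k) (\<chi> i. 1) = K"
    using \<open>C = P\<close> unfolding hyperbolicity_cone_def C_def esym_eq_esum by auto

  show ?thesis
    unfolding spectrahedral_def
  proof (intro exI conjI)
    show "\<forall>i. symmetric_mat m (A i)"
      by (simp add: symmetric_mat_def A_def energy_sym)
    show "pd_mat m (\<lambda>a b. \<Sum>i\<in>UNIV. (\<chi> i. 1) $ i * A i a b)"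
      using one_P unfolding pd_mat_def form P_def by simp
    show "hyperbolicity_cone (esym k) (\<chi> i. 1) = {x. psd_mat m (\<lambda>a b. \<Sum>i\<in>UNIV. x $ i * A i a b)}"
      unfolding cone psd_mat_def form K_def ..
  qed
qed

end
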